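(* Given an untwisted ($F=NS$) or $\mu$-twisted ($F=R$) super spectral curve as in the context, there is at most one family $(\omega_{g,n|2m})$ of multilinear differentials respecting the polarization (with the stated symmetry properties) that satisfies the abstract super loop equations. More precisely, each $\omega_{g,n|2m}$ of such a solution is uniquely determined by the $\omega_{g',n'|2m'}$ with $2g'+n'+2m'<2g+n+2m$ together with the curve data.
   Context: Fix $F\in\{NS,R\}$, $f=\frac12$ if $F=NS$, $f=0$ if $F=R$. Curve data: integer $N\ge1$; $\tau_l,Q_l\in\mathbb C$ ($l\ge-(N-1)$) with $\tau_{-(N-1)}\neq0$; $\phi_{kl}=\phi_{lk}$ ($k,l\ge1$); $D_1,\dots,D_N$; $\psi^F_{kl}$ ($k,l\ge0$) with $\psi^{NS}$ antisymmetric if $F=NS$, and $\psi^R_{00}=0$, $\psi^R_{kl}+\psi^R_{lk}+\psi^R_{0k}\psi^R_{0l}=0$ if $F=R$. Bases: $d\xi_l(z)=z^{l-1}dz$ ($l\ge1$), $d\xi_0(z)=dz/z$, $d\xi_{-l}(z)=z^{-l-1}dz+\sum_{m\ge1}\frac{\phi_{lm}}{l}d\xi_m(z)$ ($l\ge1$). With a Grassmann variable $\theta$: $\Theta^{NS}_z=\theta+dz\,\partial_\theta$, $\Theta^R_z=\theta+z\,dz\,\partial_\theta$; write $\Theta^F_z$ (and $\Theta^F_i$ for the variable $(z_i,\theta_i)$). If $F=NS$: $\eta_{l+1/2}=z^l\Theta^{NS}_z$, $\eta_{-l-1/2}=(z^{-l-1}+\sum_{k\ge0}\psi^{NS}_{lk}z^k)\Theta^{NS}_z$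 for $l\ge0$. If $F=R$: $\eta_l=z^{l-1}\Theta^R_z$ ($l\ge1$), $\eta_0=(z^{-1}+\sum_{k\ge1}\psi^R_{0k}z^{k-1})\Theta^R_z$, $\eta_{-l}=(z^{-l-1}+\sum_{k\ge0}\psi^R_{lk}z^{k-1})\Theta^R_z$ ($l\ge1$). $V^{B-}_z$ is spanned by $d\xi_{-l}$, $l\ge1$; $V^{F-}_u$ by $\eta_{-j-f}(u,\theta)$, $j\ge0$; $V^{B+}_z=\mathbb C\llbracket z\rrbracket dz$, $V^{F+}_z=\mathbb C\llbracket z\rrbracket\Theta^F_z$. Given differentials: $\omega_{0,1|0}(z)=\sum_{l\ge-(N-1)}\tau_ld\xi_l(z)$; $\omega_{\frac12,1|0}(z)=\sum_{l\ge-(N-1)}Q_ld\xi_l(z)$ (so $\mathrm{Res}_{z\to0}\omega_{\frac12,1|0}=Q_0$); $\omega_{1,1|0}(z)=\sum_{k=1}^ND_kd\xi_{-k}(z)$; $\omega_{0,2|0}(z_1,z_2)=\frac{dz_1dz_2}{(z_1-z_2)^2}+\sum_{k,l\ge1}\phi_{kl}d\xi_k(z_1)d\xi_l(z_2)$; $\omega_{0,0|2}=\omega^F_{0,0|2}$ with $\omega^{NS}_{0,0|2}(|z_1,z_2)=-\frac{\Theta^{NS}_1\Theta^{NS}_2}{z_1-z_2}+\sum_{k,l\ge0}\psi^{NS}_{kl}\eta_{k+\frac12}(z_1)\eta_{l+\frac12}(z_2)$ and $\omega^R_{0,0|2}(|z_1,z_2)=-\frac12\frac{z_1+z_2}{z_1-z_2}\frac{\Theta^R_1\Theta^R_2}{z_1z_2}-\sum_{k,l\ge1}\frac{\psi^R_{k-1,l-1}-\psi^R_{l-1,k-1}}{1+\delta_{(k-1)(l-1),0}}\frac{\eta_l(z_1)\eta_k(z_2)}{2z_1z_2}$.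 Unknowns: for $g\in\frac12\mathbb Z_{\ge0}$, $n,m\ge0$, $2g+n+2m\ge3$, $(g,n,m)\ne(1,1,0)$, a differential $\omega_{g,n|2m}(z_1,\dots,z_n|u_1,\dots,u_{2m})\in\bigotimes_kV^{B-}_{z_k}\otimes\bigotimes_lV^{F-}_{u_l}$ ("respecting the polarization"; $u_l$ stands for $(u_l,\theta_l)$), symmetric in the $z$'s and antisymmetric in the $u$'s; in the formulas below, $\omega$'s with the listed unstable indices mean the given differentials above and all other $\omega$ with $2g+n+2m\le2$ are zero. Operator $\mathcal D_z$: $\mathcal D_z\cdot(h(z)dz)=dh(z)\,dz$, $\mathcal D_z\cdot(h(z)\Theta^F_z)=dh(z)\,\Theta^F_z$. Writing $I=(z_1,\dots)$, $J$ fermionic variables, $(-1)^\rho$ the sign of the permutation $J\mapsto J_1\cup J_2$, and sums over $g_1+g_2=g$ ($g_i\in\frac12\mathbb Z_{\ge0}$) and all splittings $I=I_1\sqcup I_2$, $J=J_1\sqcup J_2$ with $n_i=|I_i|$ and matching $m_i$: $\mathcal Q^{BF}_{g,n|2m}(I|z,J)=\omega_{g-1,n+1|2m}(z,I|z,J)+Q_0\big(\mathcal D_z\cdot\omega_{g-\frac12,n|2m}(I|z,J)+\frac{1-2f}{2}d\xi_0(z)\omega_{g-\frac12,n|2m}(I|z,J)\big)+\sum(-1)^\rho\omega_{g_1,n_1+1|2m_1}(z,I_1|J_1)\,\omega_{g_2,n_2|2m_2}(I_2|z,J_2)$; $\mathcal Q^{BB}_{g,n+1|2m}(z,I|J)=\omega_{g-1,n+2|2m}(z,z,I|J)+\frac12Q_0\,\mathcal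 D_z\cdot\omega_{g-\frac12,n+1|2m}(z,I|J)+\sum(-1)^\rho\omega_{g_1,n_1+1|2m_1}(z,I_1|J_1)\,\omega_{g_2,n_2+1|2m_2}(z,I_2|J_2)$; $\mathcal Q^{FF}_{g,n+1|2m}(z,I|J)=-\frac12\mathcal D_z\cdot\omega_{g-1,n|2m+2}(I|z,u,J)\big|_{u=z}+\frac12\sum(-1)^\rho\mathcal D_z\cdot\omega_{g_1,n_1|2m_1}(I_1|z,J_1)\,\omega_{g_2,n_2|2m_2}(I_2|z,J_2)$. Abstract super loop equations: (1) for $2g+n+2m\ge2$, $(g,n,m)\ne(1,0,0)$: $\mathcal Q^{BB}_{g,n+1|2m}(z,I|J)+\mathcal Q^{FF}_{g,n+1|2m}(z,I|J)\in z^{-N-1}V^{B+}_z\otimes V^{B+}_z$ as a function of $z$; (2) for $2g+n+2m\ge3$: $\mathcal Q^{BF}_{g,n|2m}(I|z,J)\in z^{-N-1}V^{B+}_z\otimes V^{F+}_z$ as a function of $z$. *)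

theory Defs
  imports "HOL-Analysis.Analysis"
begin

text \<open>
Genus g is encoded by G = 2g :: nat.  The flavour F is encoded by the boolean ns
(True: F = NS, f = 1/2;  False: F = R, f = 0).
A differential in several variables is encoded by its coefficient function on
exponent vectors: for bosonic variables z_k the exponent e_k means z_k^{e_k} dz_k,
for fermionic variables u_j the exponent d_j means u_j^{d_j} Theta_j
(the Theta-factors kept in positional order).
\<close>

record curve =
  ns   :: bool
  NN   :: nat
  tau  :: "int \<Rightarrow> complex"          \<comment> \<open>tau_l, l \<ge> -(N-1)\<close>
  Qc   :: "int \<Rightarrow> complex"          \<comment> \<open>Q_l, l \<ge> -(N-1)\<close>
  phi  :: "nat \<Rightarrow> nat \<Rightarrow> complex"   \<comment> \<open>phi_kl, k,l \<ge> 1\<close>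
  Dc   :: "nat \<Rightarrow> complex"          \<comment> \<open>D_1,...,D_N\<close>
  psi  :: "nat \<Rightarrow> nat \<Rightarrow> complex"   \<comment> \<open>psi^F_kl, k,l \<ge> 0\<close>

text \<open>c = 1 - 2f\<close>
definition cf :: "curve \<Rightarrow> int" where
  "cf C = (if ns C then 0 else 1)"

text \<open>Coefficient of z^e dz in d xi_{-(a+1)}(z) = z^{-a-2} dz + sum_m phi_{a+1,m}/(a+1) z^{m-1} dz.\<close>
definition dxi_neg :: "curve \<Rightarrow> nat \<Rightarrow> int \<Rightarrow> complex" where
  "dxi_neg C a e =
     (if e = - int a - 2 then 1 else 0)
   + (if 0 \<le> e then phi C (a + 1) (nat e + 1) / of_nat (a + 1) else 0)"

text \<open>Coefficient of z^e dz in d xi_l(z), l an arbitrary integer.\<close>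
definition dxi :: "curve \<Rightarrow> int \<Rightarrow> int \<Rightarrow> complex" where
  "dxi C l e =
     (if 1 \<le> l then (if e = l - 1 then 1 else 0)
      else if l = 0 then (if e = -1 then 1 else 0)
      else dxi_neg C (nat (- l) - 1) e)"

text \<open>Coefficient of z^e Theta_z in eta_{-j-f}(z), j \<ge> 0.\<close>
definition eta_neg :: "curve \<Rightarrow> nat \<Rightarrow> int \<Rightarrow> complex" where
  "eta_neg C j e =
     (if ns C then
        (if e = - int j - 1 then 1 else 0) + (if 0 \<le> e then psi C j (nat e) else 0)
      else if j = 0 then
        (if e = -1 then 1 else 0) + (if 0 \<le> e then psi C 0 (nat e + 1) else 0)
      else
        (if e = - int j - 1 then 1 else 0) + (if -1 \<le> e then psi C j (nat (e + 1)) else 0))"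

text \<open>omega_{0,1|0}(z) = sum_{l \<ge> -(N-1)} tau_l d xi_l(z): coefficient of z^e dz.\<close>
definition om01 :: "curve \<Rightarrow> int \<Rightarrow> complex" where
  "om01 C e = infsum (\<lambda>l. tau C l * dxi C l e) {1 - int (NN C)..}"

text \<open>omega_{1/2,1|0}(z) = sum_{l \<ge> -(N-1)} Q_l d xi_l(z).\<close>
definition om_half1 :: "curve \<Rightarrow> int \<Rightarrow> complex" where
  "om_half1 C e = infsum (\<lambda>l. Qc C l * dxi C l e) {1 - int (NN C)..}"

text \<open>omega_{1,1|0}(z) = sum_{k=1}^N D_k d xi_{-k}(z).\<close>
definition om11 :: "curve \<Rightarrow> int \<Rightarrow> complex" where
  "om11 C e = (\<Sum>k\<in>{1..NN C}. Dc C k * dxi_neg C (k - 1) e)"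

text \<open>omega_{0,2|0}(z,w), coefficient of z^a w^b dz dw, expanded as a function of z near 0
  (i.e. in the region |z| < |w|): 1/(z-w)^2 = sum_{k\<ge>1} k z^{k-1} w^{-k-1}.\<close>
definition om02 :: "curve \<Rightarrow> int \<Rightarrow> int \<Rightarrow> complex" where
  "om02 C a b =
     (if 0 \<le> a \<and> b = - a - 2 then of_int (a + 1) else 0)
   + (if 0 \<le> a \<and> 0 \<le> b then phi C (nat a + 1) (nat b + 1) else 0)"

text \<open>omega^F_{0,0|2}(|z,u), coefficient of z^a u^b Theta_z Theta_u, expanded in |z| < |u|.
  NS: -1/(z-u) = sum_{k\<ge>0} z^k u^{-k-1}.
  R:  -(1/2)(z+u)/((z-u) z u) = (1/2) z^{-1} u^{-1} + sum_{k\<ge>1} z^{k-1} u^{-k-1}, and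
      eta_l(z) eta_k(u)/(z u) = z^{l-2} u^{k-2} Theta_z Theta_u.\<close>
definition om002 :: "curve \<Rightarrow> int \<Rightarrow> int \<Rightarrow> complex" where
  "om002 C a b =
     (if ns C then
        (if 0 \<le> a \<and> b = - a - 1 then 1 else 0)
      + (if 0 \<le> a \<and> 0 \<le> b then psi C (nat a) (nat b) else 0)
      else
        (if a = -1 \<and> b = -1 then 1/2 else 0)
      + (if 0 \<le> a \<and> b = - a - 2 then 1 else 0)
      - (if -1 \<le> a \<and> -1 \<le> b then
           (psi C (nat (b + 1)) (nat (a + 1)) - psi C (nat (a + 1)) (nat (b + 1)))
             / (1 + (if (a + 1) * (b + 1) = 0 then 1 else 0)) / 2
         else 0))"

text \<open>A family of unknowns: W G n m ls js is the coefficient of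
  prod_k d xi_{-(ls!k + 1)}(z_k) * prod_j eta_{-(js!j) - f}(u_j)
  in omega_{G/2, n|2m}(z_1..z_n | u_1..u_{2m}) (this is "respecting the polarization").\<close>
type_synonym family = "nat \<Rightarrow> nat \<Rightarrow> nat \<Rightarrow> nat list \<Rightarrow> nat list \<Rightarrow> complex"

definition unknown_index :: "nat \<Rightarrow> nat \<Rightarrow> nat \<Rightarrow> bool" where
  "unknown_index G n m \<longleftrightarrow> 3 \<le> G + n + 2 * m \<and> (G, n, m) \<noteq> (2, 1, 0)"

definition supp :: "family \<Rightarrow> nat \<Rightarrow> nat \<Rightarrow> nat \<Rightarrow> (nat list \<times> nat list) set" where
  "supp W G n m = {(ls, js). length ls = n \<and> length js = 2 * m \<and> W G n m ls js \<noteq> 0}"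

text \<open>Element of (tensor V^{B-}) (tensor V^{F-}) (finite linear combination), symmetric in the
  bosonic and antisymmetric in the fermionic slots.\<close>
definition valid_family :: "family \<Rightarrow> bool" where
  "valid_family W \<longleftrightarrow> (\<forall>G n m. unknown_index G n m \<longrightarrow>
     finite (supp W G n m)
   \<and> (\<forall>ls js i j. length ls = n \<and> length js = 2 * m \<and> i < n \<and> j < n \<longrightarrow>
        W G n m (ls[i := ls ! j, j := ls ! i]) js = W G n m ls js)
   \<and> (\<forall>ls js i j. length ls = n \<and> length js = 2 * m \<and> i < 2 * m \<and> j < 2 * m \<and> i \<noteq> j \<longrightarrow>
        W G n m ls (js[i := js ! j, j := js ! i]) = - W G n m ls js))"

text \<open>Coefficient of prod z_k^{es!k} dz_k prod u_j^{ds!j} Theta_j in omega_{G/2,n|2m}, including the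
  given (unstable) differentials; for those with two arguments the first one is the
  distinguished variable z of the loop equations (expansion near z = 0).\<close>
definition om :: "curve \<Rightarrow> family \<Rightarrow> nat \<Rightarrow> nat \<Rightarrow> nat \<Rightarrow> int list \<Rightarrow> int list \<Rightarrow> complex" where
  "om C W G n m es ds =
     (if unknown_index G n m then
        (\<Sum>(ls, js)\<in>supp W G n m. W G n m ls js
            * (\<Prod>k<n. dxi_neg C (ls ! k) (es ! k))
            * (\<Prod>k<2 * m. eta_neg C (js ! k) (ds ! k)))
      else if (G, n, m) = (0, 1, 0) then om01 C (es ! 0)
      else if (G, n, m) = (1, 1, 0) then om_half1 C (es ! 0)
      else if (G, n, m) = (2, 1, 0) then om11 C (es ! 0)
      else if (G, n, m) = (0, 2, 0) then om02 C (es ! 0) (es ! 1)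
      else if (G, n, m) = (0, 0, 1) then om002 C (ds ! 0) (ds ! 1)
      else 0)"

text \<open>Sign of the permutation J \<mapsto> J_1 \<union> J_2, where J = positions {..<k}, J_1 = T (in order)
  followed by J_2 = {..<k} - T (in order).\<close>
definition shuffle_sign :: "nat set \<Rightarrow> nat \<Rightarrow> complex" where
  "shuffle_sign T k = (-1) ^ card {(i, j). i \<in> T \<and> j < k \<and> j \<notin> T \<and> j < i}"

text \<open>Q^BB_{g,n+1|2m}(z,I|J): coefficient of z^p dz^2 (times the monomial es, ds in I, J).\<close>
definition QBB :: "curve \<Rightarrow> family \<Rightarrow> nat \<Rightarrow> nat \<Rightarrow> nat \<Rightarrow> int \<Rightarrow> int list \<Rightarrow> int list \<Rightarrow> complex" where
  "QBB C W G n m p es ds =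
     (if 2 \<le> G then infsum (\<lambda>a. om C W (G - 2) (n + 2) m (a # (p - a) # es) ds) UNIV else 0)
   + (if 1 \<le> G then (1/2) * Qc C 0 * of_int (p + 1) * om C W (G - 1) (n + 1) m ((p + 1) # es) ds
      else 0)
   + (\<Sum>G1\<in>{0..G}. \<Sum>S\<in>Pow {..<n}. \<Sum>T\<in>{T. T \<subseteq> {..<2 * m} \<and> even (card T)}.
        shuffle_sign T (2 * m) *
        infsum (\<lambda>a. om C W G1 (card S + 1) (card T div 2) (a # nths es S) (nths ds T)
                   * om C W (G - G1) (n - card S + 1) (m - card T div 2)
                        ((p - a) # nths es (- S)) (nths ds (- T))) UNIV)"

text \<open>Q^FF_{g,n+1|2m}(z,I|J): coefficient of z^p dz^2, using D_z (h Theta_z) = h' dz Theta_z and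
  Theta^F_z Theta^F_z = z^{1-2f} dz.\<close>
definition QFF :: "curve \<Rightarrow> family \<Rightarrow> nat \<Rightarrow> nat \<Rightarrow> nat \<Rightarrow> int \<Rightarrow> int list \<Rightarrow> int list \<Rightarrow> complex" where
  "QFF C W G n m p es ds =
     (if 2 \<le> G then - (1/2) *
        infsum (\<lambda>a. of_int a * om C W (G - 2) n (m + 1) es (a # (p + 1 - cf C - a) # ds)) UNIV
      else 0)
   + (1/2) * (\<Sum>G1\<in>{0..G}. \<Sum>S\<in>Pow {..<n}. \<Sum>T\<in>{T. T \<subseteq> {..<2 * m} \<and> odd (card T)}.
        shuffle_sign T (2 * m) *
        infsum (\<lambda>a. of_int a * om C W G1 (card S) ((card T + 1) div 2) (nths es S) (a # nths ds T)
                   * om C W (G - G1) (n - card S) ((2 * m - card T + 1) div 2)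
                        (nths es (- S)) ((p + 1 - cf C - a) # nths ds (- T))) UNIV)"

text \<open>Q^BF_{g,n|2m}(I|z,J) (J has 2m-1 entries): coefficient of z^p dz Theta_z.\<close>
definition QBF :: "curve \<Rightarrow> family \<Rightarrow> nat \<Rightarrow> nat \<Rightarrow> nat \<Rightarrow> int \<Rightarrow> int list \<Rightarrow> int list \<Rightarrow> complex" where
  "QBF C W G n m p es ds =
     (if 2 \<le> G then infsum (\<lambda>a. om C W (G - 2) (n + 1) m (a # es) ((p - a) # ds)) UNIV else 0)
   + (if 1 \<le> G then Qc C 0 * (of_int (p + 1) + of_int (cf C) / 2) * om C W (G - 1) n m es ((p + 1) # ds)
      else 0)
   + (\<Sum>G1\<in>{0..G}. \<Sum>S\<in>Pow {..<n}. \<Sum>T\<in>{T. T \<subseteq> {..<2 * m - 1} \<and> even (card T)}.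
        shuffle_sign T (2 * m - 1) *
        infsum (\<lambda>a. om C W G1 (card S + 1) (card T div 2) (a # nths es S) (nths ds T)
                   * om C W (G - G1) (n - card S) (m - card T div 2)
                        (nths es (- S)) ((p - a) # nths ds (- T))) UNIV)"

text \<open>Abstract super loop equations: no coefficients of z^p with p < -N-1.\<close>
definition loop_eqs :: "curve \<Rightarrow> family \<Rightarrow> bool" where
  "loop_eqs C W \<longleftrightarrow>
     (\<forall>G n m. 2 \<le> G + n + 2 * m \<and> (G, n, m) \<noteq> (2, 0, 0) \<longrightarrow>
        (\<forall>p es ds. p < - int (NN C) - 1 \<and> length es = n \<and> length ds = 2 * m \<longrightarrow>
           QBB C W G n m p es ds + QFF C W G n m p es ds = 0))
   \<and> (\<forall>G n m. 3 \<le> G + n + 2 * m \<and> 1 \<le> m \<longrightarrow>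
        (\<forall>p es ds. p < - int (NN C) - 1 \<and> length es = n \<and> length ds = 2 * m - 1 \<longrightarrow>
           QBF C W G n m p es ds = 0))"

definition agree_at :: "family \<Rightarrow> family \<Rightarrow> nat \<Rightarrow> nat \<Rightarrow> nat \<Rightarrow> bool" where
  "agree_at W W' G n m \<longleftrightarrow>
     (\<forall>ls js. length ls = n \<and> length js = 2 * m \<longrightarrow> W G n m ls js = W' G n m ls js)"

end

theory Submission
  imports Defs
begin

text \<open>By induction on 2g + n + 2m. Take the loop equation Q^BB + Q^FF = 0 with n bosonic
  arguments, or Q^BF = 0 if there are none. Every term in it involves only lower levels, except
  the products of omega_{g,n|2m} with omega_{0,1|0}, which has a pole of order exactly N with
  leading coefficient tau_{-(N-1)} \<noteq> 0. Hence the vanishing of the coefficients of z^p for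
  p < -N-1 is a linear system for the coefficients of the difference of two solutions in the
  basis d xi_{-l-1}, eta_{-j-f}; evaluated at the dual exponents it is triangular with nonzero
  diagonal, so the difference vanishes. For n = 0 this only reaches the coefficients whose
  first fermionic index is nonzero, and antisymmetry gives the rest.\<close>

section \<open>Pole structure of the basis differentials\<close>

lemma om01_eq_0_below_pole:
  assumes "1 \<le> NN C" "e < - int (NN C)"
  shows "om01 C e = 0"
  unfolding om01_def by (rule infsum_0) (use assms in \<open>auto simp: dxi_def dxi_neg_def\<close>)

lemma om01_pole_coeff:
  assumes "1 \<le> NN C"
  shows "om01 C (- int (NN C)) = tau C (1 - int (NN C))"
proof -
  have "om01 C (- int (NN C)) = infsum (\<lambda>l. tau C l * dxi C l (- int (NN C))) {1 - int (NN C)}"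
    unfolding om01_def by (rule infsum_cong_neutral) (use assms in \<open>auto simp: dxi_def dxi_neg_def\<close>)
  then show ?thesis using assms by (simp add: dxi_def dxi_neg_def)
qed

lemma dxi_neg_negative_exp:
  "e < 0 \<Longrightarrow> dxi_neg C l e = (if e = - int l - 2 then 1 else 0)"
  unfolding dxi_neg_def by auto

lemma eta_neg_exp_le_minus_2:
  "d \<le> -2 \<Longrightarrow> eta_neg C j d = (if d = - int j - 1 then 1 else 0)"
  unfolding eta_neg_def by auto

lemma eta_neg_dual_exp: "eta_neg C j (- int j - 1) = 1"
  unfolding eta_neg_def by auto

text \<open>For F = R the residue part of every eta_{-j} is psi_{j0} u^{-1}, so the coefficient of
  u^{-1} Theta_u does not single out eta_0.\<close>
lemma eta_neg_dual_exp_nonzero: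
  "eta_neg C j' (- int j - 1) \<noteq> 0 \<Longrightarrow> j' = j \<or> j = 0"
  unfolding eta_neg_def by (auto split: if_splits)

section \<open>Coefficients in the basis\<close>

definition basis_coeff :: "curve \<Rightarrow> nat list \<Rightarrow> nat list \<Rightarrow> int list \<Rightarrow> int list \<Rightarrow> complex" where
  "basis_coeff C ls js es ds =
     (\<Prod>k<length ls. dxi_neg C (ls ! k) (es ! k)) * (\<Prod>k<length js. eta_neg C (js ! k) (ds ! k))"

lemma basis_coeff_Cons_bos:
  "basis_coeff C (l # ls) js (e # es) ds = dxi_neg C l e * basis_coeff C ls js es ds"
  unfolding basis_coeff_def by (simp add: prod.lessThan_Suc_shift del: prod.lessThan_Suc)

lemma basis_coeff_Cons_ferm:
  "basis_coeff C ls (j # js) es (d # ds) = eta_neg C j d * basis_coeff C ls js es ds"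
  unfolding basis_coeff_def by (simp add: prod.lessThan_Suc_shift del: prod.lessThan_Suc)

lemma om_unknown:
  "unknown_index G n m \<Longrightarrow>
     om C W G n m es ds = (\<Sum>(ls, js)\<in>supp W G n m. W G n m ls js * basis_coeff C ls js es ds)"
  unfolding om_def basis_coeff_def supp_def by (auto intro!: sum.cong simp: mult.assoc)

lemma om_unknown_Cons_bos:
  assumes "unknown_index G (Suc n) m"
  shows "om C W G (Suc n) m (e # es) ds =
    (\<Sum>(ls, js)\<in>supp W G (Suc n) m.
       W G (Suc n) m ls js * basis_coeff C (tl ls) js es ds * dxi_neg C (hd ls) e)"
  unfolding om_unknown[OF assms]
proof (intro sum.cong refl, clarify)
  fix ls js assume "(ls, js) \<in> supp W G (Suc n) m"
  then have "ls = hd ls # tl ls" by (cases ls) (auto simp: supp_def)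
  then show "W G (Suc n) m ls js * basis_coeff C ls js (e # es) ds =
      W G (Suc n) m ls js * basis_coeff C (tl ls) js es ds * dxi_neg C (hd ls) e"
    by (metis basis_coeff_Cons_bos mult.assoc mult.commute)
qed

lemma om_unknown_Cons_ferm:
  assumes "unknown_index G n m" "1 \<le> m"
  shows "om C W G n m es (d # ds) =
    (\<Sum>(ls, js)\<in>supp W G n m.
       W G n m ls js * basis_coeff C ls (tl js) es ds * eta_neg C (hd js) d)"
  unfolding om_unknown[OF assms(1)]
proof (intro sum.cong refl, clarify)
  fix ls js assume "(ls, js) \<in> supp W G n m"
  then have "js = hd js # tl js" using assms(2) by (cases js) (auto simp: supp_def)
  then show "W G n m ls js * basis_coeff C ls js es (d # ds) =
      W G n m ls js * basis_coeff C ls (tl js) es ds * eta_neg C (hd js) d"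
    by (metis basis_coeff_Cons_ferm mult.assoc mult.commute)
qed

definition dual_bos :: "nat list \<Rightarrow> int list" where
  "dual_bos ls = map (\<lambda>l. - int l - 2) ls"

definition dual_ferm :: "nat list \<Rightarrow> int list" where
  "dual_ferm js = map (\<lambda>j. - int j - 1) js"

lemma basis_coeff_dual: "basis_coeff C ls js (dual_bos ls) (dual_ferm js) = 1"
  unfolding basis_coeff_def dual_bos_def dual_ferm_def
  by (simp add: dxi_neg_negative_exp eta_neg_dual_exp)

lemma basis_coeff_dual_nonzero:
  assumes "length ls' = length ls" "length js' = length js"
    and "basis_coeff C ls' js' (dual_bos ls) (dual_ferm js) \<noteq> 0"
  shows "ls' = ls" and "\<forall>k<length js. js' ! k = js ! k \<or> js ! k = 0"
proof -
  have "ls' ! k = ls ! k" if "k < length ls" for k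
    using assms that
    by (auto simp: basis_coeff_def dual_bos_def dxi_neg_negative_exp split: if_splits)
  then show "ls' = ls"
    using assms(1) by (simp add: nth_equalityI)
  have "eta_neg C (js' ! k) (- int (js ! k) - 1) \<noteq> 0" if "k < length js" for k
    using assms that by (auto simp: basis_coeff_def dual_ferm_def)
  then show "\<forall>k<length js. js' ! k = js ! k \<or> js ! k = 0"
    using eta_neg_dual_exp_nonzero by metis
qed

definition nonzero_entries :: "nat list \<Rightarrow> nat set" where
  "nonzero_entries js = {k. k < length js \<and> js ! k \<noteq> 0}"

lemma card_nonzero_entries_less:
  assumes "length js' = length js" "\<forall>k<length js. js' ! k = js ! k \<or> js ! k = 0"
  shows "card (nonzero_entries js) \<le> card (nonzero_entries js')"
    and "js' \<noteq> js \<Longrightarrow> card (nonzero_entries js) < card (nonzero_entries js')"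
proof -
  have sub: "nonzero_entries js \<subseteq> nonzero_entries js'"
    using assms by (auto simp: nonzero_entries_def)
  have fin: "finite (nonzero_entries js')" by (simp add: nonzero_entries_def)
  show "card (nonzero_entries js) \<le> card (nonzero_entries js')"
    by (rule card_mono[OF fin sub])
  assume "js' \<noteq> js"
  then obtain k where "k < length js" "js' ! k \<noteq> js ! k"
    using assms(1) nth_equalityI by metis
  then have "k \<in> nonzero_entries js' - nonzero_entries js"
    using assms by (auto simp: nonzero_entries_def)
  then show "card (nonzero_entries js) < card (nonzero_entries js')"
    using sub by (intro psubset_card_mono[OF fin]) auto
qed

section \<open>Convolution with omega_{0,1}\<close>

lemma infsum_point_masses:
  fixes v :: "'a \<Rightarrow> 'b::{comm_monoid_add, t2_space}"
  assumes "finite A"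
  shows "infsum (\<lambda>x. \<Sum>a\<in>A. if x = pt a then v a else 0) UNIV = (\<Sum>a\<in>A. v a)"
proof -
  have "infsum (\<lambda>x. \<Sum>a\<in>A. if x = pt a then v a else 0) UNIV
      = infsum (\<lambda>x. \<Sum>a\<in>A. if x = pt a then v a else 0) (pt ` A)"
    by (rule infsum_cong_neutral) (auto intro!: sum.neutral)
  also have "\<dots> = (\<Sum>x\<in>pt ` A. \<Sum>a\<in>A. if x = pt a then v a else 0)"
    using assms by simp
  also have "\<dots> = (\<Sum>a\<in>A. \<Sum>x\<in>pt ` A. if x = pt a then v a else 0)"
    by (rule sum.swap)
  also have "\<dots> = (\<Sum>a\<in>A. v a)"
    using assms by (simp add: sum.delta)
  finally show ?thesis .
qed

text \<open>Since p < -N-1, wherever omega_{0,1}(x) is nonzero the exponent p - x of the other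
  factor is at most -2, where every basis differential is a single monomial.\<close>
lemma infsum_om01_convolution:
  assumes N: "1 \<le> NN C" and p: "p < - int (NN C) - 1" and A: "finite A"
    and polar: "\<And>a z. a \<in> A \<Longrightarrow> z \<le> -2 \<Longrightarrow> \<kappa> a z = (if z = \<epsilon> a then 1 else 0)"
  shows "infsum (\<lambda>x. om01 C x * (\<Sum>a\<in>A. c a * \<kappa> a (p - x))) UNIV
       = (\<Sum>a\<in>A. c a * om01 C (p - \<epsilon> a))"
proof -
  have "om01 C x * (\<Sum>a\<in>A. c a * \<kappa> a (p - x))
      = (\<Sum>a\<in>A. if x = p - \<epsilon> a then c a * om01 C (p - \<epsilon> a) else 0)" for x
  proof (cases "x < - int (NN C)")
    case True
    then show ?thesis using om01_eq_0_below_pole[OF N] by (auto intro!: sum.neutral)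
  next
    case False
    then have "p - x \<le> -2" using p by simp
    then show ?thesis using polar by (auto simp: sum_distrib_left intro!: sum.cong)
  qed
  then show ?thesis by (simp add: infsum_point_masses[OF A])
qed

lemma infsum_convolution_om01:
  assumes "1 \<le> NN C" "p < - int (NN C) - 1" "finite A"
    and "\<And>a z. a \<in> A \<Longrightarrow> z \<le> -2 \<Longrightarrow> \<kappa> a z = (if z = \<epsilon> a then 1 else 0)"
  shows "infsum (\<lambda>x. (\<Sum>a\<in>A. c a * \<kappa> a x) * om01 C (p - x)) UNIV
       = (\<Sum>a\<in>A. c a * om01 C (p - \<epsilon> a))"
proof -
  have "infsum (\<lambda>x. (\<Sum>a\<in>A. c a * \<kappa> a x) * om01 C (p - x)) UNIV
      = infsum (\<lambda>x. om01 C x * (\<Sum>a\<in>A. c a * \<kappa> a (p - x))) UNIV"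
    by (rule infsum_reindex_bij_witness[of UNIV "\<lambda>x. p - x" "\<lambda>x. p - x"]) (auto simp: mult.commute)
  then show ?thesis using infsum_om01_convolution[OF assms] by simp
qed

lemma infsum_om01_om_Cons_bos:
  assumes "1 \<le> NN C" "p < - int (NN C) - 1" "unknown_index G (Suc n) m"
    and "finite (supp W G (Suc n) m)"
  shows "infsum (\<lambda>x. om01 C x * om C W G (Suc n) m ((p - x) # es) ds) UNIV
    = (\<Sum>(ls, js)\<in>supp W G (Suc n) m.
         W G (Suc n) m ls js * basis_coeff C (tl ls) js es ds * om01 C (p + int (hd ls) + 2))"
  unfolding om_unknown_Cons_bos[OF assms(3)] split_def
  by (subst infsum_om01_convolution[OF assms(1,2,4), where \<epsilon> = "\<lambda>a. - int (hd (fst a)) - 2"])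
    (auto simp: dxi_neg_negative_exp algebra_simps)

lemma infsum_om_Cons_bos_om01:
  assumes "1 \<le> NN C" "p < - int (NN C) - 1" "unknown_index G (Suc n) m"
    and "finite (supp W G (Suc n) m)"
  shows "infsum (\<lambda>x. om C W G (Suc n) m (x # es) ds * om01 C (p - x)) UNIV
    = (\<Sum>(ls, js)\<in>supp W G (Suc n) m.
         W G (Suc n) m ls js * basis_coeff C (tl ls) js es ds * om01 C (p + int (hd ls) + 2))"
  unfolding om_unknown_Cons_bos[OF assms(3)] split_def
  by (subst infsum_convolution_om01[OF assms(1,2,4), where \<epsilon> = "\<lambda>a. - int (hd (fst a)) - 2"])
    (auto simp: dxi_neg_negative_exp algebra_simps)

lemma infsum_om01_om_Cons_ferm:
  assumes "1 \<le> NN C" "p < - int (NN C) - 1" "unknown_index G n m" "1 \<le> m"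
    and "finite (supp W G n m)"
  shows "infsum (\<lambda>x. om01 C x * om C W G n m es ((p - x) # ds)) UNIV
    = (\<Sum>(ls, js)\<in>supp W G n m.
         W G n m ls js * basis_coeff C ls (tl js) es ds * om01 C (p + int (hd js) + 1))"
  unfolding om_unknown_Cons_ferm[OF assms(3,4)] split_def
  by (subst infsum_om01_convolution[OF assms(1,2,5), where \<epsilon> = "\<lambda>a. - int (hd (snd a)) - 1"])
    (auto simp: eta_neg_exp_le_minus_2 algebra_simps)

section \<open>Triangular linear systems\<close>

lemma triangular_system_zero:
  fixes c :: "'a \<Rightarrow> 'b::ring_no_zero_divisors" and B :: "'t \<Rightarrow> 'a \<Rightarrow> 'b"
    and w :: "'a \<Rightarrow> 'w::linorder"
  assumes fin: "finite A"
    and eq: "\<And>t. Q t \<Longrightarrow> (\<Sum>a\<in>A. c a * B t a) = 0"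
    and test: "\<And>a. a \<in> A \<Longrightarrow> P a \<Longrightarrow> Q (x a)"
    and diag: "\<And>a. a \<in> A \<Longrightarrow> P a \<Longrightarrow> B (x a) a \<noteq> 0"
    and tri: "\<And>a a'. a \<in> A \<Longrightarrow> a' \<in> A \<Longrightarrow> P a \<Longrightarrow> a' \<noteq> a \<Longrightarrow> B (x a) a' \<noteq> 0 \<Longrightarrow>
      P a' \<and> w a < w a'"
  shows "\<forall>a\<in>A. P a \<longrightarrow> c a = 0"
proof (rule ccontr)
  define S where "S = {a\<in>A. P a \<and> c a \<noteq> 0}"
  assume "\<not> (\<forall>a\<in>A. P a \<longrightarrow> c a = 0)"
  then have "S \<noteq> {}" and finS: "finite S" using fin by (auto simp: S_def)
  then have "Max (w ` S) \<in> w ` S" by simp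
  then obtain a where "a \<in> S" and wa: "w a = Max (w ` S)" by auto
  then have a: "a \<in> A" "P a" "c a \<noteq> 0" by (auto simp: S_def)
  have amax: "w b \<le> w a" if "b \<in> A" "P b" "c b \<noteq> 0" for b
    using that finS by (simp add: wa S_def)
  have "c b * B (x a) b = 0" if "b \<in> A - {a}" for b
  proof (rule ccontr)
    assume "c b * B (x a) b \<noteq> 0"
    then have "P b" "w a < w b" "c b \<noteq> 0" using tri[OF a(1) _ a(2)] that by auto
    then show False using amax[of b] that by simp
  qed
  then have "(\<Sum>b\<in>A. c b * B (x a) b) = c a * B (x a) a"
    using fin a(1) by (simp add: sum.remove sum.neutral)
  moreover have "(\<Sum>b\<in>A. c b * B (x a) b) = 0" using eq test a by blast
  ultimately show False using a diag by simp
qed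

lemma om01_shift_nonzero:
  assumes "1 \<le> NN C" "om01 C (int h' - int h - int (NN C)) \<noteq> 0"
  shows "h \<le> h'"
  using om01_eq_0_below_pole[OF assms(1), of "int h' - int h - int (NN C)"] assms(2)
  by (cases "h \<le> h'") auto

text \<open>Testing at p = -N - s - h(a) and at the exponents dual to the monomial of a, the
  system is triangular with respect to h(a) + #(nonzero fermionic indices of a).\<close>
lemma pole_system_zero:
  fixes c :: "'a \<Rightarrow> complex" and h :: "'a \<Rightarrow> nat" and bl fl :: "'a \<Rightarrow> nat list"
  assumes N: "1 \<le> NN C" and tau: "tau C (1 - int (NN C)) \<noteq> 0" and A: "finite A"
    and inj: "inj_on (\<lambda>a. (h a, bl a, fl a)) A"
    and len: "\<And>a. a \<in> A \<Longrightarrow> length (bl a) = n \<and> length (fl a) = k"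
    and eq: "\<And>p es ds. p < - int (NN C) - 1 \<Longrightarrow> length es = n \<Longrightarrow> length ds = k \<Longrightarrow>
      (\<Sum>a\<in>A. c a * (basis_coeff C (bl a) (fl a) es ds * om01 C (p + int (h a) + int s))) = 0"
  shows "\<forall>a\<in>A. 1 < h a + s \<longrightarrow> c a = 0"
proof (rule triangular_system_zero[OF A])
  define x where "x a = (- int (NN C) - int s - int (h a), dual_bos (bl a), dual_ferm (fl a))" for a
  define B where "B t a = basis_coeff C (bl a) (fl a) (fst (snd t)) (snd (snd t))
      * om01 C (fst t + int (h a) + int s)" for t :: "int \<times> int list \<times> int list" and a
  define w where "w a = h a + card (nonzero_entries (fl a))" for a
  have Bx: "B (x a) a' = basis_coeff C (bl a') (fl a') (dual_bos (bl a)) (dual_ferm (fl a))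
      * om01 C (int (h a') - int (h a) - int (NN C))" for a a'
    by (simp add: B_def x_def algebra_simps)
  show "(\<Sum>a\<in>A. c a * B t a) = 0"
    if "fst t < - int (NN C) - 1 \<and> length (fst (snd t)) = n \<and> length (snd (snd t)) = k" for t
    using that eq by (simp add: B_def)
  show "fst (x a) < - int (NN C) - 1 \<and> length (fst (snd (x a))) = n \<and> length (snd (snd (x a))) = k"
    if "a \<in> A" "1 < h a + s" for a
    using that len by (simp add: x_def dual_bos_def dual_ferm_def)
  show "B (x a) a \<noteq> 0" for a
    by (simp add: Bx basis_coeff_dual om01_pole_coeff[OF N] tau)
  show "1 < h a' + s \<and> w a < w a'"
    if a: "a \<in> A" "a' \<in> A" "1 < h a + s" "a' \<noteq> a" and nz: "B (x a) a' \<noteq> 0" for a a'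
  proof -
    have lens: "length (bl a') = length (bl a)" "length (fl a') = length (fl a)"
      using a len by auto
    have "h a \<le> h a'" using om01_shift_nonzero[OF N] nz by (auto simp: Bx)
    moreover have "basis_coeff C (bl a') (fl a') (dual_bos (bl a)) (dual_ferm (fl a)) \<noteq> 0"
      using nz by (auto simp: Bx)
    note dom = basis_coeff_dual_nonzero[OF lens this]
    have "w a < w a'"
    proof (cases "h a = h a'")
      case True
      then have "fl a' \<noteq> fl a" using dom(1) inj a by (auto dest: inj_onD)
      then show ?thesis
        using True card_nonzero_entries_less(2)[OF lens(2) dom(2)] by (simp add: w_def)
    next
      case False
      then show ?thesis
        using \<open>h a \<le> h a'\<close> card_nonzero_entries_less(1)[OF lens(2) dom(2)] by (simp add: w_def)
    qed
    ultimately show ?thesis using a(3) by simp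
  qed
qed

section \<open>The loop equations at the top level\<close>

definition lower_agree :: "family \<Rightarrow> family \<Rightarrow> nat \<Rightarrow> bool" where
  "lower_agree W W' L \<longleftrightarrow>
     (\<forall>G n m. unknown_index G n m \<and> 1 \<le> n + m \<and> G + n + 2 * m < L \<longrightarrow> agree_at W W' G n m)"

lemma om_eq_if_agree_at:
  assumes "unknown_index G n m \<longrightarrow> agree_at W W' G n m"
  shows "om C W G n m = om C W' G n m"
proof (cases "unknown_index G n m")
  case True
  then have ag: "agree_at W W' G n m" using assms by simp
  then have "supp W G n m = supp W' G n m" by (auto simp: supp_def agree_at_def)
  with True ag show ?thesis
    by (auto intro!: ext sum.cong simp: om_unknown supp_def agree_at_def)
qed (auto intro!: ext simp: om_def)

lemma om_eq_if_lower_agree: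
  "lower_agree W W' L \<Longrightarrow> G + n + 2 * m < L \<Longrightarrow> 1 \<le> n + m \<Longrightarrow> om C W G n m = om C W' G n m"
  unfolding lower_agree_def by (intro om_eq_if_agree_at) auto

lemma sum3_diff_concentrated:
  fixes f g :: "'x \<Rightarrow> 'y \<Rightarrow> 'z \<Rightarrow> 'b::ab_group_add"
  assumes "finite X" "finite Y" "finite Z" "D \<subseteq> X \<times> Y \<times> Z"
    and "\<And>x y z. x \<in> X \<Longrightarrow> y \<in> Y \<Longrightarrow> z \<in> Z \<Longrightarrow> (x, y, z) \<notin> D \<Longrightarrow> f x y z = g x y z"
  shows "(\<Sum>x\<in>X. \<Sum>y\<in>Y. \<Sum>z\<in>Z. f x y z) - (\<Sum>x\<in>X. \<Sum>y\<in>Y. \<Sum>z\<in>Z. g x y z)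
       = (\<Sum>(x, y, z)\<in>D. f x y z - g x y z)"
proof -
  have "(\<Sum>x\<in>X. \<Sum>y\<in>Y. \<Sum>z\<in>Z. f x y z) - (\<Sum>x\<in>X. \<Sum>y\<in>Y. \<Sum>z\<in>Z. g x y z)
      = (\<Sum>(x, y, z)\<in>X \<times> Y \<times> Z. f x y z - g x y z)"
    by (simp add: sum.cartesian_product case_prod_unfold sum_subtractf)
  also have "\<dots> = (\<Sum>(x, y, z)\<in>D. f x y z - g x y z)"
    by (rule sum.mono_neutral_right) (use assms in \<open>auto intro: finite_subset\<close>)
  finally show ?thesis .
qed

lemma sum_supp_diff:
  assumes "finite (supp W G n m)" "finite (supp W' G n m)"
  shows "(\<Sum>(ls, js)\<in>supp W G n m. W G n m ls js * f ls js)
       - (\<Sum>(ls, js)\<in>supp W' G n m. W' G n m ls js * f ls js)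
     = (\<Sum>(ls, js)\<in>supp W G n m \<union> supp W' G n m. (W G n m ls js - W' G n m ls js) * f ls js)"
proof -
  have "(\<Sum>(ls, js)\<in>supp V G n m. V G n m ls js * f ls js)
      = (\<Sum>(ls, js)\<in>supp W G n m \<union> supp W' G n m. V G n m ls js * f ls js)"
    if "V = W \<or> V = W'" for V
    by (rule sum.mono_neutral_left) (use assms that in \<open>auto simp: supp_def\<close>)
  then show ?thesis
    by (simp add: sum_subtractf[symmetric] case_prod_unfold left_diff_distrib)
qed

lemma QFF_eq_if_lower_agree:
  assumes low: "lower_agree W W' (G + (n + 1) + 2 * m)"
  shows "QFF C W G n m p es ds = QFF C W' G n m p es ds"
proof -
  have "2 \<le> G \<Longrightarrow> om C W (G - 2) n (m + 1) = om C W' (G - 2) n (m + 1)"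
    by (rule om_eq_if_lower_agree[OF low]) auto
  moreover have "om C W G1 (card S) ((card T + 1) div 2) = om C W' G1 (card S) ((card T + 1) div 2)
      \<and> om C W (G - G1) (n - card S) ((2 * m - card T + 1) div 2)
        = om C W' (G - G1) (n - card S) ((2 * m - card T + 1) div 2)"
    if "G1 \<le> G" "S \<subseteq> {..<n}" "T \<subseteq> {..<2 * m}" "odd (card T)" for G1 S T
  proof -
    have "card S \<le> n" "card T \<le> 2 * m"
      using that card_mono[OF finite_lessThan] by fastforce+
    with that show ?thesis
      by (intro conjI om_eq_if_lower_agree[OF low]; presburger)
  qed
  ultimately show ?thesis
    unfolding QFF_def
    by (intro arg_cong2[where f = "(+)"] arg_cong[where f = "\<lambda>x. (1/2) * x"] sum.cong) auto
qed

definition QBB_term :: "curve \<Rightarrow> family \<Rightarrow> nat \<Rightarrow> nat \<Rightarrow> nat \<Rightarrow> int \<Rightarrow> int list \<Rightarrow> int list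
    \<Rightarrow> nat \<Rightarrow> nat set \<Rightarrow> nat set \<Rightarrow> complex" where
  "QBB_term C V G n m p es ds G1 S T = shuffle_sign T (2 * m) *
     infsum (\<lambda>a. om C V G1 (card S + 1) (card T div 2) (a # nths es S) (nths ds T)
              * om C V (G - G1) (n - card S + 1) (m - card T div 2)
                  ((p - a) # nths es (- S)) (nths ds (- T))) UNIV"

lemma QBB_term_levels_below:
  assumes G1: "G1 \<le> G" and S: "S \<subseteq> {..<n}" and T: "T \<subseteq> {..<2 * m}" and eT: "even (card T)"
    and "(G1, S, T) \<noteq> (0, {}, {})" "(G1, S, T) \<noteq> (G, {..<n}, {..<2 * m})"
  shows "G1 + (card S + 1) + 2 * (card T div 2) < G + (n + 1) + 2 * m"
    and "G - G1 + (n - card S + 1) + 2 * (m - card T div 2) < G + (n + 1) + 2 * m"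
proof -
  have cS: "card S \<le> n" using S by (metis card_lessThan card_mono finite_lessThan)
  have cT: "card T \<le> 2 * m" using T by (metis card_lessThan card_mono finite_lessThan)
  have "finite S" "finite T" using S T finite_subset by blast+
  then have d1: "G1 \<noteq> 0 \<or> card S \<noteq> 0 \<or> card T \<noteq> 0" using assms(5) by auto
  have "card S = n \<Longrightarrow> S = {..<n}" using card_subset_eq[OF finite_lessThan S] by simp
  moreover have "card T = 2 * m \<Longrightarrow> T = {..<2 * m}" using card_subset_eq[OF finite_lessThan T] by simp
  ultimately have d2: "G1 \<noteq> G \<or> card S \<noteq> n \<or> card T \<noteq> 2 * m" using assms(6) by auto
  show "G1 + (card S + 1) + 2 * (card T div 2) < G + (n + 1) + 2 * m"
    using d2 cS cT eT G1 by presburger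
  show "G - G1 + (n - card S + 1) + 2 * (m - card T div 2) < G + (n + 1) + 2 * m"
    using d1 cS cT eT G1 by presburger
qed

text \<open>The two extreme terms are the ones containing omega_{0,1}; all other terms of the
  quadratic sum only involve lower levels.\<close>
lemma QBB_diff_eq_extreme_terms:
  assumes low: "lower_agree W W' (G + (n + 1) + 2 * m)" and unk: "unknown_index G (Suc n) m"
  shows "QBB C W G n m p es ds - QBB C W' G n m p es ds
    = (QBB_term C W G n m p es ds 0 {} {} - QBB_term C W' G n m p es ds 0 {} {})
    + (QBB_term C W G n m p es ds G {..<n} {..<2 * m} - QBB_term C W' G n m p es ds G {..<n} {..<2 * m})"
proof -
  define Ts where "Ts = {T. T \<subseteq> {..<2 * m} \<and> even (card T)}"
  define D where "D = {(0, {}, {}), (G, {..<n}, {..<2 * m})}"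
  have Dne: "(0::nat, {}::nat set, {}::nat set) \<noteq> (G, {..<n}, {..<2 * m})"
    using unk lessThan_empty_iff[of n] lessThan_empty_iff[of "2 * m"]
    by (auto simp: unknown_index_def)
  have "2 \<le> G \<Longrightarrow> om C W (G - 2) (n + 2) m = om C W' (G - 2) (n + 2) m"
    and "1 \<le> G \<Longrightarrow> om C W (G - 1) (n + 1) m = om C W' (G - 1) (n + 1) m"
    by (rule om_eq_if_lower_agree[OF low]; simp)+
  then have "QBB C W G n m p es ds - QBB C W' G n m p es ds
      = (\<Sum>G1\<in>{0..G}. \<Sum>S\<in>Pow {..<n}. \<Sum>T\<in>Ts. QBB_term C W G n m p es ds G1 S T)
      - (\<Sum>G1\<in>{0..G}. \<Sum>S\<in>Pow {..<n}. \<Sum>T\<in>Ts. QBB_term C W' G n m p es ds G1 S T)"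
    unfolding QBB_def QBB_term_def Ts_def by (cases "2 \<le> G"; cases "1 \<le> G") auto
  also have "\<dots> = (\<Sum>(G1, S, T)\<in>D.
      QBB_term C W G n m p es ds G1 S T - QBB_term C W' G n m p es ds G1 S T)"
  proof (rule sum3_diff_concentrated)
    show "D \<subseteq> {0..G} \<times> Pow {..<n} \<times> Ts" by (auto simp: D_def Ts_def)
    fix G1 S T assume "G1 \<in> {0..G}" "S \<in> Pow {..<n}" "T \<in> Ts" "(G1, S, T) \<notin> D"
    then have lv: "G1 \<le> G" "S \<subseteq> {..<n}" "T \<subseteq> {..<2 * m}" "even (card T)"
      "(G1, S, T) \<noteq> (0, {}, {})" "(G1, S, T) \<noteq> (G, {..<n}, {..<2 * m})"
      by (auto simp: D_def Ts_def)
    have "om C W G1 (card S + 1) (card T div 2) = om C W' G1 (card S + 1) (card T div 2)"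
      and "om C W (G - G1) (n - card S + 1) (m - card T div 2)
         = om C W' (G - G1) (n - card S + 1) (m - card T div 2)"
      by (rule om_eq_if_lower_agree[OF low QBB_term_levels_below(1)[OF lv]], simp)
        (rule om_eq_if_lower_agree[OF low QBB_term_levels_below(2)[OF lv]], simp)
    then show "QBB_term C W G n m p es ds G1 S T = QBB_term C W' G n m p es ds G1 S T"
      unfolding QBB_term_def by simp
  qed (auto simp: Ts_def)
  also have "\<dots> = (QBB_term C W G n m p es ds 0 {} {} - QBB_term C W' G n m p es ds 0 {} {})
      + (QBB_term C W G n m p es ds G {..<n} {..<2 * m} - QBB_term C W' G n m p es ds G {..<n} {..<2 * m})"
    using Dne by (simp add: D_def)
  finally show ?thesis .
qed

lemma om_0_1_0: "om C W 0 (Suc 0) 0 es ds = om01 C (es ! 0)"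
  by (simp add: om_def unknown_index_def)

lemma shuffle_sign_empty: "shuffle_sign {} k = 1"
  by (simp add: shuffle_sign_def)

lemma shuffle_sign_all: "shuffle_sign {..<k} k = 1"
proof -
  have "{(i, j). i \<in> {..<k} \<and> j < k \<and> j \<notin> {..<k} \<and> j < i} = {}" by auto
  then show ?thesis by (simp only: shuffle_sign_def card.empty power_0)
qed

lemma QBB_diff:
  assumes N: "1 \<le> NN C" and p: "p < - int (NN C) - 1"
    and low: "lower_agree W W' (G + (n + 1) + 2 * m)" and unk: "unknown_index G (Suc n) m"
    and fin: "finite (supp W G (Suc n) m)" "finite (supp W' G (Suc n) m)"
    and len: "length es = n" "length ds = 2 * m"
  shows "QBB C W G n m p es ds - QBB C W' G n m p es ds
    = 2 * (\<Sum>(ls, js)\<in>supp W G (Suc n) m \<union> supp W' G (Suc n) m.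
          (W G (Suc n) m ls js - W' G (Suc n) m ls js)
          * (basis_coeff C (tl ls) js es ds * om01 C (p + int (hd ls) + 2)))"
proof -
  have extreme: "QBB_term C V G n m p es ds 0 {} {}
       = infsum (\<lambda>x. om01 C x * om C V G (Suc n) m ((p - x) # es) ds) UNIV"
      "QBB_term C V G n m p es ds G {..<n} {..<2 * m}
       = infsum (\<lambda>x. om C V G (Suc n) m (x # es) ds * om01 C (p - x)) UNIV" for V
    using len by (simp_all add: QBB_term_def shuffle_sign_empty shuffle_sign_all om_0_1_0 nths_all)
  show ?thesis
    unfolding QBB_diff_eq_extreme_terms[OF low unk] extreme
      infsum_om01_om_Cons_bos[OF N p unk fin(1)] infsum_om01_om_Cons_bos[OF N p unk fin(2)]
      infsum_om_Cons_bos_om01[OF N p unk fin(1)] infsum_om_Cons_bos_om01[OF N p unk fin(2)]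
    by (simp add: sum_supp_diff[OF fin] mult.assoc)
qed

definition QBF_term :: "curve \<Rightarrow> family \<Rightarrow> nat \<Rightarrow> nat \<Rightarrow> nat \<Rightarrow> int \<Rightarrow> int list \<Rightarrow> int list
    \<Rightarrow> nat \<Rightarrow> nat set \<Rightarrow> nat set \<Rightarrow> complex" where
  "QBF_term C V G n m p es ds G1 S T = shuffle_sign T (2 * m - 1) *
     infsum (\<lambda>a. om C V G1 (card S + 1) (card T div 2) (a # nths es S) (nths ds T)
              * om C V (G - G1) (n - card S) (m - card T div 2)
                  (nths es (- S)) ((p - a) # nths ds (- T))) UNIV"

lemma QBF_term_levels_below:
  assumes G1: "G1 \<le> G" and S: "S \<subseteq> {..<n}" and T: "T \<subseteq> {..<2 * m - 1}" and eT: "even (card T)"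
    and m: "1 \<le> m" and "(G1, S, T) \<noteq> (0, {}, {})"
  shows "G1 + (card S + 1) + 2 * (card T div 2) < G + n + 2 * m"
    and "G - G1 + (n - card S) + 2 * (m - card T div 2) < G + n + 2 * m"
    and "1 \<le> n - card S + (m - card T div 2)"
proof -
  have cS: "card S \<le> n" using S by (metis card_lessThan card_mono finite_lessThan)
  have cT: "card T \<le> 2 * m - 1" using T by (metis card_lessThan card_mono finite_lessThan)
  have "finite S" "finite T" using S T finite_subset by blast+
  then have d1: "G1 \<noteq> 0 \<or> card S \<noteq> 0 \<or> card T \<noteq> 0" using assms(6) by auto
  show "G1 + (card S + 1) + 2 * (card T div 2) < G + n + 2 * m"
    using cS cT eT G1 m by presburger
  show "G - G1 + (n - card S) + 2 * (m - card T div 2) < G + n + 2 * m"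
    using d1 cS cT eT G1 m by presburger
  show "1 \<le> n - card S + (m - card T div 2)"
    using cS cT eT m by presburger
qed

lemma QBF_diff_eq_first_term:
  assumes low: "lower_agree W W' (G + n + 2 * m)" and m: "1 \<le> m"
  shows "QBF C W G n m p es ds - QBF C W' G n m p es ds
    = QBF_term C W G n m p es ds 0 {} {} - QBF_term C W' G n m p es ds 0 {} {}"
proof -
  define Ts where "Ts = {T. T \<subseteq> {..<2 * m - 1} \<and> even (card T)}"
  have "2 \<le> G \<Longrightarrow> om C W (G - 2) (n + 1) m = om C W' (G - 2) (n + 1) m"
    and "1 \<le> G \<Longrightarrow> om C W (G - 1) n m = om C W' (G - 1) n m"
    by (rule om_eq_if_lower_agree[OF low]; use m in simp)+
  then have "QBF C W G n m p es ds - QBF C W' G n m p es ds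
      = (\<Sum>G1\<in>{0..G}. \<Sum>S\<in>Pow {..<n}. \<Sum>T\<in>Ts. QBF_term C W G n m p es ds G1 S T)
      - (\<Sum>G1\<in>{0..G}. \<Sum>S\<in>Pow {..<n}. \<Sum>T\<in>Ts. QBF_term C W' G n m p es ds G1 S T)"
    unfolding QBF_def QBF_term_def Ts_def by (cases "2 \<le> G"; cases "1 \<le> G") auto
  also have "\<dots> = (\<Sum>(G1, S, T)\<in>{(0, {}, {})}.
      QBF_term C W G n m p es ds G1 S T - QBF_term C W' G n m p es ds G1 S T)"
  proof (rule sum3_diff_concentrated)
    fix G1 S T assume "G1 \<in> {0..G}" "S \<in> Pow {..<n}" "T \<in> Ts" "(G1, S, T) \<notin> {(0, {}, {})}"
    then have lv: "G1 \<le> G" "S \<subseteq> {..<n}" "T \<subseteq> {..<2 * m - 1}" "even (card T)" "1 \<le> m"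
      "(G1, S, T) \<noteq> (0, {}, {})"
      using m by (auto simp: Ts_def)
    have "om C W G1 (card S + 1) (card T div 2) = om C W' G1 (card S + 1) (card T div 2)"
      and "om C W (G - G1) (n - card S) (m - card T div 2)
         = om C W' (G - G1) (n - card S) (m - card T div 2)"
      by (rule om_eq_if_lower_agree[OF low QBF_term_levels_below(1)[OF lv]], simp)
        (rule om_eq_if_lower_agree[OF low QBF_term_levels_below(2,3)[OF lv]])
    then show "QBF_term C W G n m p es ds G1 S T = QBF_term C W' G n m p es ds G1 S T"
      unfolding QBF_term_def by simp
  qed (auto simp: Ts_def)
  finally show ?thesis by simp
qed

lemma QBF_diff:
  assumes N: "1 \<le> NN C" and p: "p < - int (NN C) - 1" and m: "1 \<le> m"
    and low: "lower_agree W W' (G + n + 2 * m)" and unk: "unknown_index G n m"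
    and fin: "finite (supp W G n m)" "finite (supp W' G n m)"
  shows "QBF C W G n m p es ds - QBF C W' G n m p es ds
    = (\<Sum>(ls, js)\<in>supp W G n m \<union> supp W' G n m. (W G n m ls js - W' G n m ls js)
          * (basis_coeff C ls (tl js) es ds * om01 C (p + int (hd js) + 1)))"
proof -
  have first: "QBF_term C V G n m p es ds 0 {} {}
      = infsum (\<lambda>x. om01 C x * om C V G n m es ((p - x) # ds)) UNIV" for V by (simp add: QBF_term_def shuffle_sign_empty om_0_1_0 nths_all)
  show ?thesis
    unfolding QBF_diff_eq_first_term[OF low m] first
      infsum_om01_om_Cons_ferm[OF N p unk m fin(1)] infsum_om01_om_Cons_ferm[OF N p unk m fin(2)]
    by (simp add: sum_supp_diff[OF fin] mult.assoc)
qed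

section \<open>Uniqueness\<close>

lemma antisymmetric_zero_if_zero_at_nonzero_head:
  fixes h :: "nat list \<Rightarrow> 'a::field_char_0"
  assumes k: "2 \<le> k"
    and anti: "\<And>js i j. length js = k \<Longrightarrow> i < k \<Longrightarrow> j < k \<Longrightarrow> i \<noteq> j \<Longrightarrow>
      h (js[i := js ! j, j := js ! i]) = - h js"
    and head: "\<And>js. length js = k \<Longrightarrow> js ! 0 \<noteq> 0 \<Longrightarrow> h js = 0"
    and len: "length js = k"
  shows "h js = 0"
proof (cases "\<exists>i<k. js ! i \<noteq> 0")
  case True
  then obtain i where i: "i < k" "js ! i \<noteq> 0" by blast
  show ?thesis
  proof (cases "i = 0")
    case False
    have "h (js[0 := js ! i, i := js ! 0]) = 0"
      using head i k len False by (simp add: nth_list_update)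
    then show ?thesis using anti[OF len _ i(1) False[symmetric]] k by simp
  qed (use head i len in simp)
next
  case False
  then have "js ! 0 = js ! 1" using k len by simp
  then have "js[0 := js ! 1, 1 := js ! 0] = js" by (metis list_update_id)
  then have "h js = - h js" using anti[OF len, of 0 1] k by simp
  then show ?thesis by (simp add: eq_neg_iff_add_eq_0)
qed

lemma agree_at_if_agree_on_supp:
  assumes "\<And>ls js. (ls, js) \<in> supp W G n m \<union> supp W' G n m \<Longrightarrow> W G n m ls js = W' G n m ls js"
  shows "agree_at W W' G n m"
  using assms by (fastforce simp: agree_at_def supp_def)

lemma agree_at_bos:
  assumes N: "1 \<le> NN C" and tau: "tau C (1 - int (NN C)) \<noteq> 0"
    and valid: "valid_family W" "valid_family W'" and loop: "loop_eqs C W" "loop_eqs C W'"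
    and low: "lower_agree W W' (G + Suc n + 2 * m)" and unk: "unknown_index G (Suc n) m"
  shows "agree_at W W' G (Suc n) m"
proof -
  let ?A = "supp W G (Suc n) m \<union> supp W' G (Suc n) m"
  have fin: "finite (supp W G (Suc n) m)" "finite (supp W' G (Suc n) m)"
    using valid unk by (auto simp: valid_family_def)
  have loop_index: "2 \<le> G + n + 2 * m \<and> (G, n, m) \<noteq> (2, 0, 0)"
    using unk by (auto simp: unknown_index_def)
  have "(\<Sum>(ls, js)\<in>?A. (W G (Suc n) m ls js - W' G (Suc n) m ls js)
      * (basis_coeff C (tl ls) js es ds * om01 C (p + int (hd ls) + 2))) = 0"
    if p: "p < - int (NN C) - 1" and len: "length es = n" "length ds = 2 * m" for p es ds
  proof -
    have "QBB C V G n m p es ds + QFF C V G n m p es ds = 0" if "loop_eqs C V" for V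
      using that loop_index p len by (auto simp: loop_eqs_def)
    then have "QBB C W G n m p es ds - QBB C W' G n m p es ds = 0"
      using loop QFF_eq_if_lower_agree[of W W' G n m C p es ds] low
      by (simp add: eq_neg_iff_add_eq_0[symmetric])
    then show ?thesis using QBB_diff[OF N p _ unk fin len] low by simp
  qed
  moreover have "inj_on (\<lambda>a. (hd (fst a), tl (fst a), snd a)) ?A"
    by (rule inj_onI) (auto simp: supp_def intro: list.expand)
  ultimately have "\<forall>a\<in>?A. 1 < hd (fst a) + 2 \<longrightarrow>
      case_prod (\<lambda>ls js. W G (Suc n) m ls js - W' G (Suc n) m ls js) a = 0"
    by (intro pole_system_zero[OF N tau, where s = 2 and n = n and k = "2 * m"])
      (use fin in \<open>auto simp: supp_def split_def\<close>)
  then show ?thesis by (intro agree_at_if_agree_on_supp) force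
qed

lemma agree_at_ferm:
  assumes N: "1 \<le> NN C" and tau: "tau C (1 - int (NN C)) \<noteq> 0"
    and valid: "valid_family W" "valid_family W'" and loop: "loop_eqs C W" "loop_eqs C W'"
    and low: "lower_agree W W' (G + 2 * m)" and unk: "unknown_index G 0 m" and m: "1 \<le> m"
  shows "agree_at W W' G 0 m"
proof -
  let ?A = "supp W G 0 m \<union> supp W' G 0 m"
  have fin: "finite (supp W G 0 m)" "finite (supp W' G 0 m)"
    using valid unk by (auto simp: valid_family_def)
  have "(\<Sum>(ls, js)\<in>?A. (W G 0 m ls js - W' G 0 m ls js)
      * (basis_coeff C ls (tl js) es ds * om01 C (p + int (hd js) + 1))) = 0"
    if p: "p < - int (NN C) - 1" and len: "length es = 0" "length ds = 2 * m - 1" for p es ds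
  proof -
    have "QBF C V G 0 m p es ds = 0" if "loop_eqs C V" for V
      using that unk m p len by (auto simp: loop_eqs_def unknown_index_def)
    then show ?thesis using QBF_diff[OF N p m _ unk fin, of es ds] loop low by simp
  qed
  moreover have "inj_on (\<lambda>a. (hd (snd a), fst a, tl (snd a))) ?A"
    using m by (intro inj_onI) (auto simp: supp_def intro: list.expand)
  ultimately have zero: "\<forall>a\<in>?A. 1 < hd (snd a) + 1 \<longrightarrow>
      case_prod (\<lambda>ls js. W G 0 m ls js - W' G 0 m ls js) a = 0"
    by (intro pole_system_zero[OF N tau, where s = 1 and n = 0 and k = "2 * m - 1"])
      (use fin in \<open>auto simp: supp_def split_def\<close>)
  have head: "W G 0 m [] js - W' G 0 m [] js = 0" if "length js = 2 * m" "js ! 0 \<noteq> 0" for js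
  proof (cases "([], js) \<in> ?A")
    case True
    have "hd js = js ! 0" using that m by (intro hd_conv_nth) auto
    then show ?thesis using zero[THEN bspec, OF True] that by simp
  qed (use that in \<open>auto simp: supp_def\<close>)
  have "W G 0 m [] js - W' G 0 m [] js = 0" if "length js = 2 * m" for js
  proof (rule antisymmetric_zero_if_zero_at_nonzero_head
      [where h = "\<lambda>js. W G 0 m [] js - W' G 0 m [] js"])
    show "W G 0 m [] (js[i := js ! j, j := js ! i]) - W' G 0 m [] (js[i := js ! j, j := js ! i])
        = - (W G 0 m [] js - W' G 0 m [] js)"
      if "length js = 2 * m" "i < 2 * m" "j < 2 * m" "i \<noteq> j" for js i j
      using valid unk that by (simp add: valid_family_def)
  qed (use m head that in auto)
  then show ?thesis by (simp add: agree_at_def)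
qed

lemma agree_at_if_lower_agree:
  assumes "1 \<le> NN C" "tau C (1 - int (NN C)) \<noteq> 0"
    and "valid_family W" "valid_family W'" "loop_eqs C W" "loop_eqs C W'"
    and "lower_agree W W' (G + n + 2 * m)" "unknown_index G n m" "1 \<le> n + m"
  shows "agree_at W W' G n m"
  using assms agree_at_bos[OF assms(1-6)] agree_at_ferm[OF assms(1-6)] by (cases n) auto

theorem proposition2p8:
  fixes C :: curve and W W' :: family
  assumes "1 \<le> NN C"
    and "tau C (1 - int (NN C)) \<noteq> 0"
    and "\<forall>k l. 1 \<le> k \<and> 1 \<le> l \<longrightarrow> phi C k l = phi C l k"
    and "ns C \<longrightarrow> (\<forall>k l. psi C k l = - psi C l k)"
    and "\<not> ns C \<longrightarrow> psi C 0 0 = 0 \<and> (\<forall>k l. psi C k l + psi C l k + psi C 0 k * psi C 0 l = 0)"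
    and "valid_family W" and "valid_family W'"
    and "loop_eqs C W" and "loop_eqs C W'"
  shows "(\<forall>G n m. unknown_index G n m \<and> 1 \<le> n + m \<longrightarrow> agree_at W W' G n m)
       \<and> (\<forall>G n m. unknown_index G n m \<and> 1 \<le> n + m
            \<and> (\<forall>G' n' m'. unknown_index G' n' m' \<and> 1 \<le> n' + m'
                 \<and> G' + n' + 2 * m' < G + n + 2 * m \<longrightarrow> agree_at W W' G' n' m')
            \<longrightarrow> agree_at W W' G n m)"
proof -
  note step = agree_at_if_lower_agree[OF assms(1,2,6-9)]
  have "lower_agree W W' L" for L
  proof (induction L)
    case (Suc L)
    then show ?case using step by (auto simp: lower_agree_def less_Suc_eq)
  qed (simp add: lower_agree_def)
  then show ?thesis using step by (auto simp: lower_agree_def)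
qed

end
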